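(* Let $\mu$ be an upper Ahlfors $n$-dimensional measure on $\mathbb{R}^d$, let $1<p<\infty$, and let $B$ be a Young function such that $B\in B_p$. Then $\mathcal{M}_B$ is bounded from $L^p(\mu)$ to $L^p(\mu)$, i.e. there is a constant $C$ such that $\|\mathcal{M}_B f\|_{L^p(\mu)}\le C\|f\|_{L^p(\mu)}$ for all $f\in L^p(\mu)$.
   Context: Fix an integer $d\ge1$ and a real number $n$ with $0<n\le d$. All cubes are cubes in $\mathbb{R}^d$ with sides parallel to the coordinate axes; $l(Q)$ is the side length of $Q$. An upper Ahlfors $n$-dimensional measure on $\mathbb{R}^d$ is a non-negative Borel measure $\mu$ with $\mu(Q)\le l(Q)^n$ for every cube $Q$. A Young function is a convex increasing function $B:[0,\infty)\to[0,\infty)$ with $B(0)=0$ and $B(t)\to\infty$ as $t\to\infty$. For $1<p<\infty$, $B\in B_p$ means that there is $c>0$ with $\int_c^\infty\frac{B(t)}{t^p}\frac{dt}{t}<\infty$. The radial Luxemburg average is $$\|f\|_{B,Q}=\inf\Big\{\lambda>0:\ \frac1{l(Q)^n}\int_Q B\Big(\frac{|f(x)|}{\lambda}\Big)\,d\mu(x)\le 1\Big\},$$ and $\mathcal{M}_{B}(f)(x)=\sup_{Q\ni x}\|f\|_{B,Q}$, the supremum being over all cubes $Q$ containing $x$. *)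

theory Defs
  imports "HOL-Analysis.Analysis"
begin

text \<open>
  Cubes are closed and non-degenerate (the side length \<open>l\<close> is required to be positive wherever a
  cube is quantified over); \<open>cube a l\<close> is the product of the intervals \<open>[a\<^sub>i, a\<^sub>i + l]\<close>.
\<close>

definition cube :: "'a::euclidean_space \<Rightarrow> real \<Rightarrow> 'a set" where
  "cube a l = cbox a (a + l *\<^sub>R One)"

definition upper_Ahlfors :: "real \<Rightarrow> 'a::euclidean_space measure \<Rightarrow> bool" where
  "upper_Ahlfors n \<mu> \<longleftrightarrow>
     sets \<mu> = sets borel \<and>
     (\<forall>a l. 0 < l \<longrightarrow> emeasure \<mu> (cube a l) \<le> ennreal (l powr n))"

text \<open>
  A function \<open>[0,\<infinity>) \<rightarrow> [0,\<infinity>)\<close> is a function on \<^typ>\<open>real\<close> whose values at negative arguments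
  are irrelevant. ``Increasing'' is read in the weak sense.
\<close>

definition young_function :: "(real \<Rightarrow> real) \<Rightarrow> bool" where
  "young_function B \<longleftrightarrow>
     (\<forall>t\<ge>0. 0 \<le> B t) \<and> convex_on {0..} B \<and> mono_on {0..} B \<and> B 0 = 0 \<and>
     filterlim B at_top at_top"

definition B_class :: "real \<Rightarrow> (real \<Rightarrow> real) set" where
  "B_class p = {B. \<exists>c>0. (\<integral>\<^sup>+t\<in>{c..}. ennreal (B t / t powr p / t) \<partial>lborel) < \<infinity>}"

text \<open>
  The average of \<open>f\<close> over \<open>cube a l\<close>, normalised by \<open>l\<^sup>n\<close> rather than by the measure of the cube.
  It is extended-real valued, so that the infimum of the empty set is \<open>\<infinity>\<close>.
\<close>

definition luxemburg ::
  "real \<Rightarrow> 'a::euclidean_space measure \<Rightarrow> (real \<Rightarrow> real) \<Rightarrow> ('a \<Rightarrow> real) \<Rightarrow> 'a \<Rightarrow> real \<Rightarrow> ennreal"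
where
  "luxemburg n \<mu> B f a l =
     Inf {ennreal lam | lam. 0 < lam \<and>
       ennreal (1 / l powr n) * (\<integral>\<^sup>+x\<in>cube a l. ennreal (B (\<bar>f x\<bar> / lam)) \<partial>\<mu>) \<le> 1}"

definition maximal_op ::
  "real \<Rightarrow> 'a::euclidean_space measure \<Rightarrow> (real \<Rightarrow> real) \<Rightarrow> ('a \<Rightarrow> real) \<Rightarrow> 'a \<Rightarrow> ennreal"
where
  "maximal_op n \<mu> B f x = (SUP (a, l) \<in> {(a, l). 0 < l \<and> x \<in> cube a l}. luxemburg n \<mu> B f a l)"

text \<open>Real powers on \<open>[0,\<infinity>]\<close>, with \<open>\<infinity>\<^sup>q = \<infinity>\<close>; only used for \<open>q > 0\<close>.\<close>

definition epowr :: "ennreal \<Rightarrow> real \<Rightarrow> ennreal" where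
  "epowr x q = (if x = \<infinity> then \<infinity> else ennreal (enn2real x powr q))"

definition Lp_norm :: "'a measure \<Rightarrow> real \<Rightarrow> ('a \<Rightarrow> ennreal) \<Rightarrow> ennreal" where
  "Lp_norm M p g = epowr (\<integral>\<^sup>+x. epowr (g x) p \<partial>M) (1 / p)"

definition Lp :: "'a measure \<Rightarrow> real \<Rightarrow> ('a \<Rightarrow> real) set" where
  "Lp M p = {f \<in> borel_measurable M. Lp_norm M p (\<lambda>x. ennreal \<bar>f x\<bar>) < \<infinity>}"

end

theory Submission
  imports Defs
begin

text \<open>
  The idea is to bound the distribution function of \<open>\<M>\<^sub>B f\<close> at height \<open>t\<close> by an integral over the set
  where \<open>\<bar>f\<bar>\<close> exceeds a fixed multiple of \<open>t\<close>, and then to integrate in \<open>t\<close>.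

  If \<open>\<M>\<^sub>B f x > t\<close>, some cube \<open>Q\<close> around \<open>x\<close> satisfies \<open>l(Q)\<^sup>n < \<integral>\<^sub>Q B(\<bar>f\<bar>/t) d\<mu>\<close>. Fix \<open>s > 0\<close> with
  \<open>B s \<le> 1/2\<close>. Since \<open>\<mu>(Q) \<le> l(Q)\<^sup>n\<close>, the points of \<open>Q\<close> with \<open>\<bar>f\<bar> \<le> s t\<close> contribute at most half of
  \<open>l(Q)\<^sup>n\<close>, so that \<open>l(Q)\<^sup>n\<close> is at most twice the integral over the points of \<open>Q\<close> with \<open>\<bar>f\<bar> > s t\<close>
  (\<open>luxemburg_greater_large_values\<close>). The Vitali covering lemma selects disjoint cubes of this kind
  whose dilates cover \<open>{\<M>\<^sub>B f > t}\<close>. The growth condition bounds the measure of a dilate by a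
  constant times \<open>l(Q)\<^sup>n\<close>; because the averages are normalised by \<open>l(Q)\<^sup>n\<close> instead of \<open>\<mu>(Q)\<close>, this
  takes the place of a doubling condition. Summing over the disjoint cubes gives
  (\<open>maximal_op_weak_type\<close>)
  \<open>\<mu>{\<M>\<^sub>B f > t} \<le> D \<integral> B(\<bar>f\<bar>/t) 1{\<bar>f\<bar> > s t} d\<mu>\<close>.

  Multiplying by \<open>p t\<^sup>p\<^sup>-\<^sup>1\<close>, integrating over \<open>t > 0\<close> and exchanging the integrals, the inner integral
  becomes \<open>\<integral> t\<^sup>p\<^sup>-\<^sup>1 B(\<bar>f x\<bar>/t) dt\<close> over \<open>0 < t < \<bar>f x\<bar>/s\<close>. Rescaling \<open>t\<close> by \<open>\<bar>f x\<bar>\<close> shows that it is at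
  most \<open>\<bar>f x\<bar>\<^sup>p\<close> times \<open>\<integral> t\<^sup>p\<^sup>-\<^sup>1 B(1/t) dt\<close> over \<open>0 < t \<le> 1/s\<close>. The substitution \<open>u = 1/t\<close> turns this
  constant into \<open>\<integral> B(u) u\<^sup>-\<^sup>p\<^sup>-\<^sup>1 du\<close> over \<open>u \<ge> s\<close>, which is finite because \<open>B \<in> B\<^sub>p\<close>
  (\<open>B_class_inverted_integral_finite\<close>).
\<close>

section \<open>Young functions\<close>

lemma young_functionD:
  assumes "young_function B"
  shows young_nonneg: "\<And>t. 0 \<le> t \<Longrightarrow> 0 \<le> B t"
    and young_mono: "\<And>t u. 0 \<le> t \<Longrightarrow> t \<le> u \<Longrightarrow> B t \<le> B u"
    and young_convex: "convex_on {0..} B"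
    and young_zero: "B 0 = 0"
  using assms by (auto simp: young_function_def mono_on_def)

text \<open>
  A Young function is constrained on \<open>[0,\<infinity>)\<close> only and may fail to be measurable on the negative
  axis. Cutting the argument off at \<open>0\<close> makes it monotone on the whole line, hence Borel.
\<close>

lemma young_measurable_max:
  assumes "young_function B"
  shows "(\<lambda>t. B (max 0 t)) \<in> borel_measurable borel"
  by (rule borel_measurable_mono) (auto simp: mono_def intro!: young_mono[OF assms])

lemma young_measurable_comp:
  assumes "young_function B" and g: "g \<in> borel_measurable M" and "\<And>x. 0 \<le> g x"
  shows "(\<lambda>x. B (g x)) \<in> borel_measurable M"
  using measurable_compose[OF g young_measurable_max[OF assms(1)]] assms(3)
  by (simp add: max_def)

text \<open>
  Convexity and \<open>B 0 = 0\<close> give \<open>B s \<le> s B 1\<close> for \<open>s \<le> 1\<close>, so \<open>B\<close> is small near \<open>0\<close>.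
\<close>

lemma young_small_value:
  assumes "young_function B"
  obtains s where "0 < s" "B s \<le> 1 / 2"
proof -
  define s where "s = 1 / (2 * (B 1 + 1))"
  have B1: "0 \<le> B 1" using young_nonneg[OF assms, of 1] by simp
  have s: "0 < s" "s \<le> 1" using B1 by (auto simp: s_def field_simps)
  have "B ((1 - s) *\<^sub>R 0 + s *\<^sub>R 1) \<le> (1 - s) * B 0 + s * B 1"
    using s by (intro convex_onD[OF young_convex[OF assms]]) auto
  also have "\<dots> = s * B 1" using young_zero[OF assms] by simp
  also have "\<dots> \<le> 1 / 2" using B1 by (simp add: s_def field_simps)
  finally have "B s \<le> 1 / 2" by simp
  with s(1) show ?thesis by (rule that)
qed

text \<open>
  The \<open>B\<^sub>p\<close> condition holds from some \<open>c\<close> on; on \<open>[s, c]\<close>, if this is not empty, the integrand is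
  bounded, so the starting point can be any \<open>s > 0\<close>.
\<close>

lemma B_class_tail_integral_finite:
  assumes B: "young_function B" "B \<in> B_class p" and s: "0 < s"
  shows "(\<integral>\<^sup>+u. ennreal (B u * u powr (- p - 1)) * indicator {s..} u \<partial>lborel) < \<infinity>"
proof -
  obtain c where c: "c > 0"
    and fin: "(\<integral>\<^sup>+t\<in>{c..}. ennreal (B t / t powr p / t) \<partial>lborel) < \<infinity>"
    using B(2) unfolding B_class_def by auto
  define K where "K = B c * (s powr (- p - 1) + c powr (- p - 1))"
  have K: "0 \<le> K" unfolding K_def using young_nonneg[OF B(1)] c by simp
  have eq: "t powr (- p - 1) = 1 / t powr p / t" if "t > 0" for t :: real
    using that powr_minus_divide[of t p] by (simp add: powr_diff)
  have Bmeas: "(\<lambda>t. B t / t powr p / t) \<in> borel_measurable (restrict_space borel {c..})"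
    using c by (intro borel_measurable_divide borel_measurable_mono_on_fnc
        measurable_restrict_space1) (auto simp: mono_on_def intro!: young_mono[OF B(1)])
  have m: "(\<lambda>t. ennreal (B t / t powr p / t) * indicator {c..} t) \<in> borel_measurable lborel"
  proof -
    have "(\<lambda>t. ennreal (B t / t powr p / t)) \<in> borel_measurable (restrict_space borel {c..})"
      using Bmeas by simp
    then show ?thesis
      by (subst (asm) borel_measurable_restrict_space_iff_ennreal) auto
  qed
  have le: "ennreal (B u * u powr (- p - 1)) * indicator {s..} u
      \<le> ennreal K * indicator {s..c} u + ennreal (B u / u powr p / u) * indicator {c..} u" for u
  proof (cases "s \<le> u")
    case True
    show ?thesis
    proof (cases "c \<le> u")
      case True
      with c eq[of u] show ?thesis by (simp add: indicator_def)
    next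
      case False
      then have uc: "u \<le> c" by simp
      have "u powr (- p - 1) \<le> s powr (- p - 1) + c powr (- p - 1)"
      proof (cases "- p - 1 \<le> 0")
        case True
        then have "u powr (- p - 1) \<le> s powr (- p - 1)"
          using \<open>s \<le> u\<close> s by (intro powr_mono2') auto
        then show ?thesis by (simp add: add_increasing2)
      next
        case False
        then have "u powr (- p - 1) \<le> c powr (- p - 1)"
          using \<open>s \<le> u\<close> s uc by (intro powr_mono2) auto
        then show ?thesis by (simp add: add_increasing)
      qed
      moreover have "B u \<le> B c" "0 \<le> B u" using \<open>s \<le> u\<close> s uc young_mono[OF B(1)] young_nonneg[OF B(1)] by auto
      ultimately have "B u * u powr (- p - 1) \<le> K" unfolding K_def by (intro mult_mono) auto
      with True uc show ?thesis by (auto simp: indicator_def ennreal_leI intro!: add_increasing2)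
    qed
  qed simp
  have "(\<integral>\<^sup>+u. ennreal (B u * u powr (- p - 1)) * indicator {s..} u \<partial>lborel)
      \<le> (\<integral>\<^sup>+u. ennreal K * indicator {s..c} u + ennreal (B u / u powr p / u) * indicator {c..} u \<partial>lborel)"
    by (intro nn_integral_mono le)
  also have "\<dots> = (\<integral>\<^sup>+u. ennreal K * indicator {s..c} u \<partial>lborel)
      + (\<integral>\<^sup>+t\<in>{c..}. ennreal (B t / t powr p / t) \<partial>lborel)"
    using m by (intro nn_integral_add) auto
  also have "\<dots> < \<infinity>"
    using fin by (simp add: nn_integral_cmult_indicator ennreal_mult_less_top emeasure_lborel_Icc_eq)
  finally show ?thesis .
qed

text \<open>
  The substitution \<open>u = 1/t\<close>, which maps \<open>[s,\<infinity>)\<close> onto \<open>(0,1/s]\<close>, carries the previous integral into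
  the one that appears after the layer cake formula.
\<close>

lemma B_class_inverted_integral_finite:
  assumes B: "young_function B" "B \<in> B_class p" and s: "0 < s"
  shows "(\<integral>\<^sup>+t. ennreal (t powr (p - 1) * B (1 / t)) * indicator {0<..1/s} t \<partial>lborel) < \<infinity>"
proof -
  define h where "h = (\<lambda>u. indicator {s..} u * (B (max 0 u) * u powr (- p - 1)))"
  define k where "k = (\<lambda>t. t powr (p - 1) * B (max 0 (1 / t)))"
  have Bm [measurable]: "(\<lambda>t. B (max 0 t)) \<in> borel_measurable borel"
    by (rule young_measurable_max[OF B(1)])
  have hm: "h \<in> borel_measurable lborel" unfolding h_def by simp
  have km: "k \<in> borel_measurable borel"
    unfolding k_def using measurable_compose[OF _ Bm, of "\<lambda>t. 1/t" borel] by simp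
  have h0: "0 \<le> h u" for u unfolding h_def using young_nonneg[OF B(1)] by simp
  have "(\<integral>\<^sup>+u. ennreal (h u) \<partial>lborel) =
      (\<integral>\<^sup>+u. ennreal (B u * u powr (- p - 1)) * indicator {s..} u \<partial>lborel)"
    using s by (intro nn_integral_cong) (auto simp: h_def indicator_def)
  with B_class_tail_integral_finite[OF assms] have "integrable lborel h"
    using h0 hm by (intro integrableI_nonneg) auto
  then have "integrable lebesgue h" by (simp add: integrable_completion hm)
  then have "(\<lambda>u. B (max 0 u) * u powr (- p - 1)) absolutely_integrable_on {s..}"
    unfolding set_integrable_def h_def by simp
  also have "?this \<longleftrightarrow> (\<lambda>u. \<bar>- (1 / u\<^sup>2)\<bar> * k (1 / u)) absolutely_integrable_on {s..}"
  proof (intro set_integrable_cong refl)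
    fix u :: real assume "u \<in> {s..}"
    then have u: "u > 0" using s by simp
    have "(1 / u) powr (p - 1) = u powr (1 - p)"
      using u powr_minus_divide[of u "p - 1"] by (simp add: powr_divide)
    moreover have "1 / u\<^sup>2 = u powr (- 2)"
      using u by (simp add: powr_minus_divide)
    moreover have "u powr (-2) * u powr (1 - p) = u powr (- p - 1)"
    proof -
      have "- p - 1 = - 2 + (1 - p)" by simp
      then show ?thesis by (simp only: powr_add)
    qed
    ultimately show "B (max 0 u) * u powr (- p - 1) = \<bar>- (1 / u\<^sup>2)\<bar> * k (1 / u)"
      using u unfolding k_def by (simp add: mult.assoc[symmetric])
  qed
  also have "\<dots> \<longleftrightarrow> k absolutely_integrable_on (\<lambda>u. 1 / u) ` {s..}"
    using s by (intro absolutely_integrable_change_of_variables_1'[symmetric])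
      (auto simp: inj_on_def power2_eq_square intro!: derivative_eq_intros)
  also have "(\<lambda>u. 1 / u) ` {s..} = {0<..1/s}"
  proof (intro equalityI subsetI)
    fix t assume "t \<in> {0<..1/s}"
    then show "t \<in> (\<lambda>u. 1 / u) ` {s..}"
      using s by (intro image_eqI[of _ _ "1/t"]) (auto simp: field_simps)
  qed (use s in \<open>auto simp: field_simps\<close>)
  finally have "integrable lborel (\<lambda>t. indicator {0<..1/s} t * k t)"
    using km by (subst (asm) set_integrable_def) (simp add: integrable_completion)
  then have "(\<integral>\<^sup>+t. ennreal (norm (indicator {0<..1/s} t * k t)) \<partial>lborel) < \<infinity>"
    by (simp add: integrable_iff_bounded)
  also have "(\<integral>\<^sup>+t. ennreal (norm (indicator {0<..1/s} t * k t)) \<partial>lborel) =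
      (\<integral>\<^sup>+t. ennreal (t powr (p - 1) * B (1 / t)) * indicator {0<..1/s} t \<partial>lborel)"
    using young_nonneg[OF B(1)]
    by (intro nn_integral_cong) (auto simp: k_def indicator_def abs_mult)
  finally show ?thesis .
qed

section \<open>Superlevel sets of the maximal function\<close>

text \<open>
  The only information about the Luxemburg average needed below is its comparison with a single
  number \<open>t\<close>. This lemma and the next translate it into the size of \<open>\<integral>\<^sub>Q B(\<bar>f\<bar>/t) d\<mu>\<close>: a value of \<open>t\<close>
  below the infimum is not admissible, and by monotonicity of \<open>B\<close> an inadmissible value is a lower
  bound of the admissible ones.
\<close>

lemma luxemburg_greaterD:
  assumes "0 < t" "0 < l" "ennreal t < luxemburg n \<mu> B f a l"
  shows "ennreal (l powr n) < (\<integral>\<^sup>+x\<in>cube a l. ennreal (B (\<bar>f x\<bar> / t)) \<partial>\<mu>)"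
    (is "_ < ?I")
proof (rule ccontr)
  assume "\<not> ennreal (l powr n) < ?I"
  then have "ennreal (1 / l powr n) * ?I \<le> ennreal (1 / l powr n) * ennreal (l powr n)"
    by (intro mult_left_mono) auto
  also have "\<dots> = 1" using assms by (simp flip: ennreal_mult)
  finally have "luxemburg n \<mu> B f a l \<le> ennreal t"
    unfolding luxemburg_def using assms(1) by (intro Inf_lower) auto
  with assms(3) show False by simp
qed

lemma luxemburg_ge:
  assumes B: "young_function B" and "0 < t" "0 < l"
    and gt: "ennreal (l powr n) < (\<integral>\<^sup>+x\<in>cube a l. ennreal (B (\<bar>f x\<bar> / t)) \<partial>\<mu>)"
  shows "ennreal t \<le> luxemburg n \<mu> B f a l"
  unfolding luxemburg_def
proof (rule Inf_greatest, clarify)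
  fix lam assume lam: "0 < lam" and
    le: "ennreal (1 / l powr n) * (\<integral>\<^sup>+x\<in>cube a l. ennreal (B (\<bar>f x\<bar> / lam)) \<partial>\<mu>) \<le> 1"
      (is "_ * ?I \<le> 1")
  have "\<not> lam < t"
  proof
    assume "lam < t"
    then have "ennreal (l powr n) < ?I"
      using lam assms(2)
      by (intro less_le_trans[OF gt] nn_integral_mono mult_right_mono ennreal_leI
          young_mono[OF B] divide_left_mono) auto
    also have "?I = ennreal (l powr n) * (ennreal (1 / l powr n) * ?I)"
      using assms(3) by (simp add: mult.assoc[symmetric] flip: ennreal_mult)
    also have "\<dots> \<le> ennreal (l powr n) * 1" using le by (intro mult_left_mono) auto
    finally show False by simp
  qed
  then show "ennreal t \<le> ennreal lam" by (simp add: ennreal_leI)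
qed

lemma maximal_op_greaterE:
  assumes "y < maximal_op n \<mu> B f x"
  obtains a l where "0 < l" "x \<in> cube a l" "y < luxemburg n \<mu> B f a l"
  using assms unfolding maximal_op_def by (auto simp: less_SUP_iff)

lemma luxemburg_le_maximal_op:
  "0 < l \<Longrightarrow> x \<in> cube a l \<Longrightarrow> luxemburg n \<mu> B f a l \<le> maximal_op n \<mu> B f x"
  unfolding maximal_op_def by (intro SUP_upper2[of "(a, l)"]) auto

lemma ennreal_dense_real:
  assumes "(y::ennreal) < z"
  obtains t where "0 < t" "y < ennreal t" "ennreal t < z"
proof -
  obtain w where w: "y < w" "w < z" using dense[OF assms] by blast
  then have "w \<noteq> \<infinity>" "w \<noteq> 0" by auto
  then obtain t where "w = ennreal t" "0 < t"
    by (cases w) (auto simp: less_le)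
  with w that show ?thesis by blast
qed

lemma mem_cube_iff: "x \<in> cube a l \<longleftrightarrow> (\<forall>i\<in>Basis. a \<bullet> i \<le> x \<bullet> i \<and> x \<bullet> i \<le> a \<bullet> i + l)"
  by (simp add: cube_def mem_box inner_add_left)

text \<open>
  Uncountable unions of closed cubes need not be Borel, but superlevel sets are even open: the
  strict inequality \<open>l\<^sup>n < \<integral>\<^sub>Q B(\<bar>f\<bar>/t) d\<mu>\<close> survives a slight enlargement of \<open>Q\<close>, since the right-hand
  side can only grow and \<open>l\<^sup>n\<close> is continuous in \<open>l\<close>. The enlarged cube contains a neighbourhood of \<open>Q\<close>.
\<close>

lemma open_maximal_op_superlevel:
  fixes \<mu> :: "'a::euclidean_space measure"
  assumes B: "young_function B"
  shows "open {x. y < maximal_op n \<mu> B f x}"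
proof (rule openI)
  fix x assume "x \<in> {x. y < maximal_op n \<mu> B f x}"
  then obtain a l where l: "0 < l" and x: "x \<in> cube a l" and gt: "y < luxemburg n \<mu> B f a l"
    by (auto elim: maximal_op_greaterE)
  \<comment> \<open>The enlarged cube only yields a weak inequality with \<open>t\<close>, hence the room between \<open>y\<close> and \<open>t\<close>.\<close>
  obtain t where t: "0 < t" "y < ennreal t" "ennreal t < luxemburg n \<mu> B f a l"
    using ennreal_dense_real[OF gt] .
  define I where "I = (\<integral>\<^sup>+x\<in>cube a l. ennreal (B (\<bar>f x\<bar> / t)) \<partial>\<mu>)"
  have "ennreal (l powr n) < I"
    unfolding I_def by (rule luxemburg_greaterD[OF t(1) l t(3)])
  moreover have "((\<lambda>e. ennreal ((l + 2 * e) powr n)) \<longlongrightarrow> ennreal ((l + 2 * 0) powr n)) (at_right 0)"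
    using l by (intro tendsto_intros) auto
  ultimately have "\<forall>\<^sub>F e in at_right 0. ennreal ((l + 2 * e) powr n) < I"
    by (intro order_tendstoD(2)) auto
  then obtain b where b: "b > 0" "\<And>e. 0 < e \<Longrightarrow> e < b \<Longrightarrow> ennreal ((l + 2 * e) powr n) < I"
    by (auto simp: eventually_at_right[of 0 1])
  define e where "e = b / 2"
  have e: "0 < e" "ennreal ((l + 2 * e) powr n) < I" using b(1) b(2)[of "b / 2"] by (auto simp: e_def)
  define a' where "a' = a - e *\<^sub>R One"
  define l' where "l' = l + 2 * e"
  have l': "0 < l'" using l e by (simp add: l'_def)
  have sub: "z \<in> cube a' l'" if "z \<in> cube a l" for z
    using that e(1) by (force simp: mem_cube_iff a'_def l'_def inner_diff_left)
  have "I \<le> (\<integral>\<^sup>+x\<in>cube a' l'. ennreal (B (\<bar>f x\<bar> / t)) \<partial>\<mu>)"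
    unfolding I_def using sub by (intro nn_integral_mono) (auto simp: indicator_def)
  with e(2) have "ennreal t \<le> luxemburg n \<mu> B f a' l'"
    by (intro luxemburg_ge[OF B t(1) l']) (auto simp: l'_def)
  with t(2) have big: "y < luxemburg n \<mu> B f a' l'" by simp
  have "open (box a' (a' + l' *\<^sub>R One))" by (rule open_box)
  moreover have "x \<in> box a' (a' + l' *\<^sub>R One)"
    using x e(1) by (force simp: mem_cube_iff mem_box a'_def l'_def inner_diff_left inner_add_left)
  ultimately obtain r where r: "r > 0" "ball x r \<subseteq> box a' (a' + l' *\<^sub>R One)"
    using open_contains_ball by metis
  have "ball x r \<subseteq> {x. y < maximal_op n \<mu> B f x}"
  proof
    fix z assume "z \<in> ball x r"
    with r have "z \<in> cube a' l'" using box_subset_cbox unfolding cube_def by blast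
    with big l' show "z \<in> {x. y < maximal_op n \<mu> B f x}"
      using luxemburg_le_maximal_op less_le_trans by blast
  qed
  with r(1) show "\<exists>T>0. ball x T \<subseteq> {x. y < maximal_op n \<mu> B f x}" by blast
qed

lemma borel_measurable_maximal_op:
  fixes \<mu> :: "'a::euclidean_space measure"
  assumes "young_function B" and sets: "sets \<mu> = sets borel"
  shows "maximal_op n \<mu> B f \<in> borel_measurable \<mu>"
proof (rule borel_measurableI_greater)
  fix y
  have "space \<mu> = UNIV" using sets_eq_imp_space_eq[OF sets] by simp
  then show "{x \<in> space \<mu>. y < maximal_op n \<mu> B f x} \<in> sets \<mu>"
    using open_maximal_op_superlevel[OF assms(1), of y n \<mu> f] by (simp add: sets)
qed


section \<open>The weak-type estimate\<close>

lemma upper_AhlforsD: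
  assumes "upper_Ahlfors n \<mu>"
  shows upper_Ahlfors_sets: "sets \<mu> = sets borel"
    and upper_Ahlfors_cube: "\<And>a l. 0 < l \<Longrightarrow> emeasure \<mu> (cube a l) \<le> ennreal (l powr n)"
  using assms by (auto simp: upper_Ahlfors_def)

lemma cube_measurable [measurable]: "cube a l \<in> sets borel"
  by (simp add: cube_def)

text \<open>
  The Vitali lemma selects Euclidean balls. A cube lies in a ball of comparable size
  centred at its corner, and a ball lies in a cube of comparable size; if the balls around two cubes
  are disjoint, so are the cubes. This costs only a dimensional factor, the norm of the diagonal of
  the unit cube.
\<close>

lemma cube_subset_cball:
  fixes a :: "'a::euclidean_space"
  assumes "0 \<le> l"
  shows "cube a l \<subseteq> cball a (l * norm (One :: 'a))"
proof
  fix x assume x: "x \<in> cube a l"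
  have "norm (x - a) \<le> norm (l *\<^sub>R (One :: 'a))"
    using x assms by (intro norm_le_componentwise) (auto simp: mem_cube_iff inner_diff_left)
  with assms show "x \<in> cball a (l * norm (One :: 'a))" by (simp add: dist_norm norm_minus_commute)
qed

lemma cball_subset_cube:
  fixes a :: "'a::euclidean_space"
  shows "cball a r \<subseteq> cube (a - r *\<^sub>R One) (2 * r)"
proof
  fix x assume "x \<in> cball a r"
  then have "norm (x - a) \<le> r" by (simp add: dist_norm norm_minus_commute)
  then have "\<bar>(x - a) \<bullet> i\<bar> \<le> r" if "i \<in> Basis" for i
    using Basis_le_norm[OF that, of "x - a"] by simp
  then show "x \<in> cube (a - r *\<^sub>R One) (2 * r)"
    by (force simp: mem_cube_iff inner_diff_left abs_le_iff)
qed

lemma sigma_finite_upper_Ahlfors: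
  fixes \<mu> :: "'a::euclidean_space measure"
  assumes "upper_Ahlfors n \<mu>"
  shows "sigma_finite_measure \<mu>"
proof
  define A where "A = range (\<lambda>k. cube (- real (Suc k) *\<^sub>R (One :: 'a)) (2 * real (Suc k)))"
  note sets = upper_Ahlfors_sets[OF assms]
  have space: "space \<mu> = UNIV" using sets_eq_imp_space_eq[OF sets] by simp
  have "\<exists>X\<in>A. x \<in> X" for x
  proof -
    obtain k where k: "norm x \<le> real k" using real_arch_simple by blast
    then have "x \<in> cball 0 (real (Suc k))" by simp
    then have "x \<in> cube (0 - real (Suc k) *\<^sub>R One) (2 * real (Suc k))"
      using cball_subset_cube by blast
    then have "x \<in> cube (- real (Suc k) *\<^sub>R One) (2 * real (Suc k))"
      by (simp only: diff_0 scaleR_minus_left)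
    then show ?thesis unfolding A_def by blast
  qed
  moreover have "emeasure \<mu> X \<noteq> \<infinity>" if X: "X \<in> A" for X
  proof -
    obtain k where "X = cube (- real (Suc k) *\<^sub>R One) (2 * real (Suc k))"
      using X unfolding A_def by blast
    moreover have "0 < 2 * real (Suc k)" by simp
    ultimately have "emeasure \<mu> X \<le> ennreal ((2 * real (Suc k)) powr n)"
      by (simp only: upper_Ahlfors_cube[OF assms])
    then have "emeasure \<mu> X < \<infinity>" by (rule le_less_trans) simp
    then show ?thesis by simp
  qed
  moreover have "countable A" "A \<subseteq> sets \<mu>" by (auto simp: A_def sets)
  ultimately show "\<exists>A. countable A \<and> A \<subseteq> sets \<mu> \<and> \<Union>A = space \<mu> \<and> (\<forall>a\<in>A. emeasure \<mu> a \<noteq> \<infinity>)"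
    by (intro exI[of _ A]) (auto simp: space)
qed

text \<open>
  Where \<open>\<bar>f\<bar> \<le> s t\<close> the integrand is at most \<open>B s \<le> 1/2\<close>, and \<open>\<mu>(Q) \<le> l\<^sup>n\<close>; this part of the integral
  is therefore at most \<open>l\<^sup>n / 2\<close> and can be absorbed into the left-hand side of
  \<open>l\<^sup>n < \<integral>\<^sub>Q B(\<bar>f\<bar>/t) d\<mu>\<close>.
\<close>

lemma luxemburg_greater_large_values:
  fixes \<mu> :: "'a::euclidean_space measure"
  assumes ahl: "upper_Ahlfors n \<mu>" and B: "young_function B"
    and s: "0 < s" "B s \<le> 1 / 2" and t: "0 < t" and l: "0 < l"
    and f [measurable]: "f \<in> borel_measurable \<mu>"
    and gt: "ennreal t < luxemburg n \<mu> B f a l"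
  shows "ennreal (l powr n) \<le>
    2 * (\<integral>\<^sup>+x\<in>cube a l. (ennreal (B (\<bar>f x\<bar> / t)) * indicator {x. s * t < \<bar>f x\<bar>} x) \<partial>\<mu>)"
    (is "_ \<le> 2 * ?I")
proof -
  note sets [measurable_cong] = upper_Ahlfors_sets[OF ahl]
  have Bm [measurable]: "(\<lambda>x. B (\<bar>f x\<bar> / t)) \<in> borel_measurable \<mu>"
    using t by (intro young_measurable_comp[OF B]) auto
  have "ennreal (l powr n) \<le> (\<integral>\<^sup>+x\<in>cube a l. ennreal (B (\<bar>f x\<bar> / t)) \<partial>\<mu>)"
    using luxemburg_greaterD[OF t l gt] by simp
  also have "\<dots> \<le> (\<integral>\<^sup>+x. ennreal (1/2) * indicator (cube a l) x +
      ennreal (B (\<bar>f x\<bar> / t)) * indicator {x. s * t < \<bar>f x\<bar>} x * indicator (cube a l) x \<partial>\<mu>)"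
  proof (rule nn_integral_mono)
    fix x
    have "B (\<bar>f x\<bar> / t) \<le> 1 / 2" if "\<not> s * t < \<bar>f x\<bar>"
      using that s t by (intro order_trans[OF young_mono[OF B] s(2)]) (auto simp: field_simps)
    then show "ennreal (B (\<bar>f x\<bar> / t)) * indicator (cube a l) x \<le>
      ennreal (1/2) * indicator (cube a l) x +
      ennreal (B (\<bar>f x\<bar> / t)) * indicator {x. s * t < \<bar>f x\<bar>} x * indicator (cube a l) x"
      by (auto simp: indicator_def simp del: ennreal_half intro!: ennreal_leI)
  qed
  also have "\<dots> = ennreal (1/2) * emeasure \<mu> (cube a l) + ?I"
    by (subst nn_integral_add) (auto simp: nn_integral_cmult_indicator sets)
  also have "\<dots> \<le> ennreal (1/2) * ennreal (l powr n) + ?I"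
    by (intro add_mono mult_left_mono upper_Ahlfors_cube[OF ahl l]) auto
  also have "ennreal (1/2) * ennreal (l powr n) = ennreal (l powr n / 2)"
    by (subst ennreal_mult[symmetric]) auto
  finally have le: "ennreal (l powr n) \<le> ennreal (l powr n / 2) + ?I" .
  show ?thesis
  proof (cases ?I)
    case (real r)
    then have "l powr n \<le> l powr n / 2 + r"
      using le by (simp flip: ennreal_plus)
    then have "ennreal (l powr n) \<le> ennreal (2 * r)" by (intro ennreal_leI) simp
    with real show ?thesis by (simp add: ennreal_mult)
  next
    case top
    then show ?thesis by (simp add: ennreal_mult_top)
  qed
qed

lemma emeasure_le_nn_integral_count_space:
  assumes C: "countable C" and Q: "\<And>i. i \<in> C \<Longrightarrow> Q i \<in> sets M" and E: "E \<subseteq> (\<Union>i\<in>C. Q i)"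
  shows "emeasure M E \<le> (\<integral>\<^sup>+i. emeasure M (Q i) \<partial>count_space C)"
proof -
  have "(\<Union>i\<in>C. Q i) \<in> sets M" using C Q by (intro sets.countable_UN'') auto
  then have "emeasure M E \<le> (\<integral>\<^sup>+x. indicator (\<Union>i\<in>C. Q i) x \<partial>M)"
    using E by (simp add: emeasure_mono)
  also have "\<dots> \<le> (\<integral>\<^sup>+x. (\<integral>\<^sup>+i. indicator (Q i) x \<partial>count_space C) \<partial>M)"
  proof (rule nn_integral_mono)
    fix x
    have "indicator (Q i) x \<le> (\<integral>\<^sup>+i. (indicator (Q i) x :: ennreal) \<partial>count_space C)"
      if "i \<in> C" for i
      using nn_integral_ge_point[OF that, of "\<lambda>i. indicator (Q i) x"] .
    then show "indicator (\<Union>i\<in>C. Q i) x \<le> (\<integral>\<^sup>+i. (indicator (Q i) x :: ennreal) \<partial>count_space C)"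
      by (fastforce simp: indicator_def split: if_splits)
  qed
  also have "\<dots> = (\<integral>\<^sup>+i. (\<integral>\<^sup>+x. indicator (Q i) x \<partial>M) \<partial>count_space C)"
    using C Q by (intro nn_integral_count_space_nn_integral) auto
  also have "\<dots> = (\<integral>\<^sup>+i. emeasure M (Q i) \<partial>count_space C)"
    using Q by (intro nn_integral_cong) auto
  finally show ?thesis .
qed

lemma nn_integral_disjoint_family_le:
  assumes C: "countable C" and Q: "\<And>i. i \<in> C \<Longrightarrow> Q i \<in> sets M"
    and disj: "disjoint_family_on Q C" and g: "g \<in> borel_measurable M"
  shows "(\<integral>\<^sup>+i. (\<integral>\<^sup>+x\<in>Q i. g x \<partial>M) \<partial>count_space C) \<le> (\<integral>\<^sup>+x. g x \<partial>M)"
proof -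
  have "(\<integral>\<^sup>+i. (\<integral>\<^sup>+x\<in>Q i. g x \<partial>M) \<partial>count_space C) =
      (\<integral>\<^sup>+i. emeasure (density M g) (Q i) \<partial>count_space C)"
    using Q g by (intro nn_integral_cong) (simp add: emeasure_density)
  also have "\<dots> = emeasure (density M g) (\<Union>i\<in>C. Q i)"
    using C Q disj by (intro emeasure_UN_countable[symmetric]) auto
  also have "\<dots> \<le> emeasure (density M g) (space (density M g))"
    by (rule emeasure_space)
  also have "\<dots> = (\<integral>\<^sup>+x. g x \<partial>M)"
    using g by (auto simp: emeasure_density intro!: nn_integral_cong)
  finally show ?thesis .
qed

text \<open>
  When the right-hand side is finite, it bounds the side length of every cube whose average exceeds
  \<open>t\<close>, as the Vitali lemma requires. In the constant, the factor \<open>2\<close> is that of the previous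
  absorption, and \<open>10 \<parallel>One\<parallel>\<close> is the dilation factor: a cube of side \<open>l\<close> lies in a ball of radius
  \<open>l \<parallel>One\<parallel>\<close>, and the ball with five times this radius lies in a cube with twice that as its side.
\<close>

lemma maximal_op_weak_type:
  fixes \<mu> :: "'a::euclidean_space measure"
  assumes n: "0 < n" and ahl: "upper_Ahlfors n \<mu>" and B: "young_function B"
    and s: "0 < s" "B s \<le> 1 / 2" and t: "0 < t" and f [measurable]: "f \<in> borel_measurable \<mu>"
  shows "emeasure \<mu> {x. ennreal t < maximal_op n \<mu> B f x} \<le>
    ennreal (2 * (10 * norm (One :: 'a)) powr n) *
      (\<integral>\<^sup>+x. ennreal (B (\<bar>f x\<bar> / t)) * indicator {x. s * t < \<bar>f x\<bar>} x \<partial>\<mu>)"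
    (is "emeasure _ ?E \<le> ennreal (2 * ?D) * ?I")
proof (cases "?I = \<infinity>")
  case True
  have "0 < 2 * ?D" by simp
  with True show ?thesis by (simp add: ennreal_mult_top)
next
  case False
  note sets [measurable_cong] = upper_Ahlfors_sets[OF ahl]
  define g where "g = (\<lambda>x. ennreal (B (\<bar>f x\<bar> / t)) * indicator {x. s * t < \<bar>f x\<bar>} x)"
  have [measurable]: "(\<lambda>x. B (\<bar>f x\<bar> / t)) \<in> borel_measurable \<mu>"
    using t by (intro young_measurable_comp[OF B]) auto
  have g [measurable]: "g \<in> borel_measurable \<mu>" unfolding g_def by measurable
  obtain R where R: "0 \<le> R" "integral\<^sup>N \<mu> g = ennreal R"
    using False by (cases "integral\<^sup>N \<mu> g") (auto simp: g_def)
  define N where "N = norm (One :: 'a)"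
  have N: "0 < N" by (simp add: N_def)
  define K where "K = {(a::'a, l). 0 < l \<and> ennreal t < luxemburg n \<mu> B f a l}"
  have K_le: "ennreal (l powr n) \<le> 2 * (\<integral>\<^sup>+x\<in>cube a l. g x \<partial>\<mu>)" if "(a, l) \<in> K" for a l
    using that luxemburg_greater_large_values[OF ahl B s t _ f]
    unfolding K_def g_def by auto
  have bound: "l \<le> (2 * R) powr (1 / n)" if "(a, l) \<in> K" for a l
  proof -
    have l: "0 < l" using that by (simp add: K_def)
    have "(\<integral>\<^sup>+x\<in>cube a l. g x \<partial>\<mu>) \<le> integral\<^sup>N \<mu> g"
      by (intro nn_integral_mono) (auto simp: indicator_def)
    moreover have twoR: "2 * ennreal R = ennreal (2 * R)" using R(1) by (simp add: ennreal_mult)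
    ultimately have "ennreal (l powr n) \<le> 2 * ennreal R"
      using K_le[OF that] R by (metis mult_left_mono order_trans zero_le)
    then have "l powr n \<le> 2 * R" using R(1) by (simp add: twoR)
    then have "(l powr n) powr (1 / n) \<le> (2 * R) powr (1 / n)"
      using n by (intro powr_mono2) auto
    then show ?thesis using l n by (simp add: powr_powr)
  qed
  have cover: "?E \<subseteq> (\<Union>i\<in>K. cball (fst i) (snd i * N))"
  proof
    fix x assume "x \<in> ?E"
    then obtain a l where "0 < l" "x \<in> cube a l" "ennreal t < luxemburg n \<mu> B f a l"
      by (auto elim: maximal_op_greaterE)
    then show "x \<in> (\<Union>i\<in>K. cball (fst i) (snd i * N))"
      using cube_subset_cball[of l a] by (intro UN_I[of "(a, l)"]) (auto simp: K_def N_def)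
  qed
  have radius: "0 < snd i * N \<and> snd i * N \<le> (2 * R) powr (1 / n) * N" if "i \<in> K" for i
    using that bound[of "fst i" "snd i"] N by (auto simp: K_def)
  obtain C where C: "countable C" "C \<subseteq> K"
     "pairwise (\<lambda>i j. disjnt (cball (fst i) (snd i * N)) (cball (fst j) (snd j * N))) C"
     "?E \<subseteq> (\<Union>i\<in>C. cball (fst i) (5 * (snd i * N)))"
    using Vitali_covering_lemma_cballs[OF cover radius] .
  \<comment> \<open>\<open>Q i\<close> is a selected cube, \<open>P i\<close> its dilate; the \<open>Q i\<close> are disjoint and the \<open>P i\<close> cover.\<close>
  define Q where "Q = (\<lambda>i::'a \<times> real. cube (fst i) (snd i))"
  define P where "P = (\<lambda>i::'a \<times> real. cube (fst i - (5 * (snd i * N)) *\<^sub>R One) (2 * (5 * (snd i * N))))"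
  have pos: "0 < snd i" if "i \<in> C" for i using that C(2) by (auto simp: K_def)
  have disj: "disjoint_family_on Q C"
    unfolding disjoint_family_on_def
  proof (intro ballI impI)
    fix i j assume ij: "i \<in> C" "j \<in> C" "i \<noteq> j"
    then have "cball (fst i) (snd i * N) \<inter> cball (fst j) (snd j * N) = {}"
      using C(3) by (auto simp: pairwise_def disjnt_def)
    moreover have "Q i \<subseteq> cball (fst i) (snd i * N)" "Q j \<subseteq> cball (fst j) (snd j * N)"
      using pos[OF ij(1)] pos[OF ij(2)] unfolding Q_def N_def
      by (simp_all add: cube_subset_cball)
    ultimately show "Q i \<inter> Q j = {}" by blast
  qed
  have "emeasure \<mu> ?E \<le> (\<integral>\<^sup>+i. emeasure \<mu> (P i) \<partial>count_space C)"
  proof (rule emeasure_le_nn_integral_count_space[OF C(1)])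
    show "?E \<subseteq> (\<Union>i\<in>C. P i)"
      unfolding P_def by (intro order_trans[OF C(4)] UN_mono cball_subset_cube order_refl)
  qed (simp add: P_def sets)
  also have "\<dots> \<le> (\<integral>\<^sup>+i. ennreal (2 * ?D) * (\<integral>\<^sup>+x\<in>Q i. g x \<partial>\<mu>) \<partial>count_space C)"
  proof (rule nn_integral_mono)
    fix i assume "i \<in> space (count_space C)"
    then have i: "i \<in> C" by simp
    have "emeasure \<mu> (P i) \<le> ennreal ((2 * (5 * (snd i * N))) powr n)"
      unfolding P_def using pos[OF i] N by (intro upper_Ahlfors_cube[OF ahl]) simp
    also have "(2 * (5 * (snd i * N))) powr n = ?D * snd i powr n"
      using pos[OF i] N by (simp add: N_def powr_mult mult_ac)
    also have "ennreal \<dots> = ennreal ?D * ennreal (snd i powr n)" by (simp add: ennreal_mult)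
    also have "\<dots> \<le> ennreal ?D * (2 * (\<integral>\<^sup>+x\<in>Q i. g x \<partial>\<mu>))"
      using K_le[of "fst i" "snd i"] i C(2) unfolding Q_def by (intro mult_left_mono) auto
    also have "\<dots> = ennreal (2 * ?D) * (\<integral>\<^sup>+x\<in>Q i. g x \<partial>\<mu>)"
      by (simp add: ennreal_mult mult_ac)
    finally show "emeasure \<mu> (P i) \<le> ennreal (2 * ?D) * (\<integral>\<^sup>+x\<in>Q i. g x \<partial>\<mu>)" .
  qed
  also have "\<dots> = ennreal (2 * ?D) * (\<integral>\<^sup>+i. (\<integral>\<^sup>+x\<in>Q i. g x \<partial>\<mu>) \<partial>count_space C)"
    by (rule nn_integral_cmult) simp
  also have "\<dots> \<le> ennreal (2 * ?D) * integral\<^sup>N \<mu> g"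
    using C(1) disj g by (intro mult_left_mono nn_integral_disjoint_family_le) (auto simp: Q_def sets)
  finally show ?thesis unfolding g_def .
qed

section \<open>From the weak-type estimate to the norm inequality\<close>

lemma nn_integral_powr_below:
  assumes "0 < p" "0 \<le> r"
  shows "(\<integral>\<^sup>+t. ennreal (p * t powr (p - 1)) * indicator {t. 0 < t \<and> t < r} t \<partial>lborel) = ennreal (r powr p)"
proof -
  have "((\<lambda>t. p * t powr (p - 1)) has_integral (p * (r powr (p - 1 + 1) / (p - 1 + 1)))) {0..r}"
    using assms by (intro has_integral_mult_right has_integral_powr_from_0) auto
  then have "(\<integral>\<^sup>+t. ennreal (p * t powr (p - 1)) * indicator {0..r} t \<partial>lborel) = ennreal (r powr p)"
    using assms by (subst nn_integral_has_integral_lebesgue') auto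
  moreover have eq: "AE t in lborel. ennreal (p * t powr (p - 1)) * indicator {t. 0 < t \<and> t < r} t =
      ennreal (p * t powr (p - 1)) * indicator {0..r} t"
    using AE_lborel_singleton[of 0] AE_lborel_singleton[of r]
    by eventually_elim (auto simp: indicator_def)
  ultimately show ?thesis by (simp add: nn_integral_cong_AE[OF eq])
qed

text \<open>
  The upper bound in \<open>y\<^sup>p = \<integral> p t\<^sup>p\<^sup>-\<^sup>1 1{t < y} dt\<close>, including \<open>y = \<infinity>\<close>, because nothing excludes beforehand
  that the maximal function takes the value \<open>\<infinity>\<close>.
\<close>

lemma epowr_layer_cake:
  assumes p: "0 < p"
  shows "epowr y p \<le> (\<integral>\<^sup>+t. ennreal (p * t powr (p - 1)) * indicator {t. 0 < t \<and> ennreal t < y} t \<partial>lborel)"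
    (is "_ \<le> ?I y")
proof (cases y)
  case (real r)
  have "?I y = ennreal (r powr p)"
    unfolding nn_integral_powr_below[OF p real(1), symmetric]
    by (intro nn_integral_cong) (auto simp: real(2) indicator_def ennreal_less_iff)
  then show ?thesis using real by (simp add: epowr_def)
next
  case top
  have "ennreal c \<le> ?I \<infinity>" if "0 \<le> c" for c
  proof -
    have "ennreal c = ennreal ((c powr (1 / p)) powr p)"
      using that p by (simp add: powr_powr)
    also have "\<dots> \<le> ?I \<infinity>"
      unfolding nn_integral_powr_below[OF p, of "c powr (1 / p)", simplified, symmetric]
      by (intro nn_integral_mono) (auto simp: indicator_def)
    finally show ?thesis .
  qed
  from this[of "enn2real (?I \<infinity>) + 1"] have "?I \<infinity> = \<infinity>"
    by (cases "?I \<infinity>") auto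
  then show ?thesis using top by simp
qed

text \<open>
  Substitute \<open>a t\<close> for \<open>t\<close>: the factor \<open>a\<^sup>p\<close> comes from \<open>t\<^sup>p\<^sup>-\<^sup>1 dt\<close>, and \<open>a\<close> disappears from the
  argument of \<open>B\<close>.
\<close>

lemma nn_integral_scaled_young_le:
  assumes B: "young_function B" and s: "0 < s" and a: "0 \<le> a"
  shows "(\<integral>\<^sup>+t. ennreal (t powr (p - 1) * B (a / t)) * indicator {t. 0 < t \<and> s * t < a} t \<partial>lborel) \<le>
    ennreal (a powr p) *
      (\<integral>\<^sup>+t. ennreal (t powr (p - 1) * B (1 / t)) * indicator {0<..1/s} t \<partial>lborel)"
proof (cases "a = 0")
  case True
  then have "indicator {t. 0 < t \<and> s * t < a} t = (0::ennreal)" for t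
    using s by (auto simp: indicator_def mult_less_0_iff)
  then show ?thesis by simp
next
  case False
  with a have a: "0 < a" by simp
  have Bm [measurable]: "(\<lambda>t. B (max 0 t)) \<in> borel_measurable borel"
    by (rule young_measurable_max[OF B])
  have Bc [measurable]: "(\<lambda>t::real. B (max 0 (c / t))) \<in> borel_measurable borel" for c
    using measurable_compose[OF _ Bm, of "\<lambda>t. c / t" borel] by simp
  let ?F = "\<lambda>t. ennreal (t powr (p - 1) * B (max 0 (a / t))) * indicator {t. 0 < t \<and> s * t < a} t"
  let ?G = "\<lambda>t. ennreal (t powr (p - 1) * B (max 0 (1 / t))) * indicator {0<..1/s} t"
  have "(\<integral>\<^sup>+t. ennreal (t powr (p - 1) * B (a / t)) * indicator {t. 0 < t \<and> s * t < a} t \<partial>lborel) =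
      (\<integral>\<^sup>+t. ?F t \<partial>lborel)"
    using a by (intro nn_integral_cong) (auto simp: indicator_def max_def)
  also have "\<dots> = ennreal a * (\<integral>\<^sup>+t. ?F (0 + a * t) \<partial>lborel)"
    using a by (subst nn_integral_real_affine[where c = a and t = 0]) auto
  also have "\<dots> \<le> ennreal a * (\<integral>\<^sup>+t. ennreal (a powr (p - 1)) * ?G t \<partial>lborel)"
  proof (intro mult_left_mono nn_integral_mono)
    fix t :: real
    show "?F (0 + a * t) \<le> ennreal (a powr (p - 1)) * ?G t"
    proof (cases "0 < t \<and> s * t < 1")
      case True
      then have "t \<le> 1 / s" using s by (simp add: field_simps)
      with True a young_nonneg[OF B] show ?thesis
        by (simp add: indicator_def powr_mult ennreal_mult mult_ac)
    next
      case False
      then have "\<not> (0 < a * t \<and> s * (a * t) < a)"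
        using a by (auto simp: zero_less_mult_iff mult.left_commute[of s])
      then have "indicator {t. 0 < t \<and> s * t < a} (0 + a * t) = (0::ennreal)" by simp
      then show ?thesis by (simp only: mult_zero_right zero_le)
    qed
  qed simp
  also have "\<dots> = ennreal a * (ennreal (a powr (p - 1)) * (\<integral>\<^sup>+t. ?G t \<partial>lborel))"
    by (subst nn_integral_cmult) auto
  also have "\<dots> = ennreal (a powr p) * (\<integral>\<^sup>+t. ?G t \<partial>lborel)"
    using a by (simp add: mult.assoc[symmetric] powr_mult_base flip: ennreal_mult)
  also have "(\<integral>\<^sup>+t. ?G t \<partial>lborel) =
      (\<integral>\<^sup>+t. ennreal (t powr (p - 1) * B (1 / t)) * indicator {0<..1/s} t \<partial>lborel)"
    by (intro nn_integral_cong) (auto simp: indicator_def max_def)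
  finally show ?thesis .
qed

text \<open>
  The layer cake formula for \<open>\<M>\<^sub>B f\<close>, the weak-type estimate at each height, Tonelli's theorem, and
  the scaling of the inner integral. Tonelli's theorem needs \<open>\<mu>\<close> to be \<open>\<sigma>\<close>-finite, which the growth
  condition ensures.
\<close>

lemma nn_integral_epowr_maximal_op_le:
  fixes \<mu> :: "'a::euclidean_space measure"
  assumes n: "0 < n" and ahl: "upper_Ahlfors n \<mu>" and B: "young_function B"
    and s: "0 < s" "B s \<le> 1 / 2" and p: "0 < p" and f [measurable]: "f \<in> borel_measurable \<mu>"
  shows "(\<integral>\<^sup>+x. epowr (maximal_op n \<mu> B f x) p \<partial>\<mu>) \<le>
    ennreal (2 * (10 * norm (One :: 'a)) powr n * p) *
    (\<integral>\<^sup>+t. ennreal (t powr (p - 1) * B (1 / t)) * indicator {0<..1/s} t \<partial>lborel) *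
    (\<integral>\<^sup>+x. epowr (ennreal \<bar>f x\<bar>) p \<partial>\<mu>)"
    (is "_ \<le> ennreal (?D * p) * ?J * _")
proof -
  note sets [measurable_cong] = upper_Ahlfors_sets[OF ahl]
  have space: "space \<mu> = UNIV" using sets_eq_imp_space_eq[OF sets] by simp
  interpret \<mu>: sigma_finite_measure \<mu> by (rule sigma_finite_upper_Ahlfors[OF ahl])
  interpret pair_sigma_finite \<mu> "lborel :: real measure" ..
  have M [measurable]: "maximal_op n \<mu> B f \<in> borel_measurable \<mu>"
    by (rule borel_measurable_maximal_op[OF B sets])
  let ?M = "maximal_op n \<mu> B f"
  let ?w = "\<lambda>t::real. ennreal (p * t powr (p - 1))"
  have Bm: "(\<lambda>(x, t::real). B (max 0 (\<bar>f x\<bar> / t))) \<in> borel_measurable (\<mu> \<Otimes>\<^sub>M lborel)"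
    using measurable_compose[OF _ young_measurable_max[OF B],
        of "\<lambda>(x, t). \<bar>f x\<bar> / t" "\<mu> \<Otimes>\<^sub>M lborel"]
    by (simp add: case_prod_unfold)
  \<comment> \<open>The right-hand side of the weak-type estimate as a jointly measurable function of \<open>x\<close> and \<open>t\<close>;
    the indicator restricts it to positive arguments of \<open>B\<close>, where \<open>max 0\<close> has no effect.\<close>
  define h where "h = (\<lambda>x t. ennreal (B (max 0 (\<bar>f x\<bar> / t))) * indicator {(x, t). 0 < t \<and> s * t < \<bar>f x\<bar>} (x, t))"
  have h [measurable]: "(\<lambda>(x, t). h x t) \<in> borel_measurable (\<mu> \<Otimes>\<^sub>M lborel)"
    using Bm unfolding h_def by (simp add: case_prod_unfold)
  have h': "(\<lambda>x. h x t) \<in> borel_measurable \<mu>" for t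
    using measurable_Pair2[OF h] measurable_compose[OF measurable_Pair2' h, of t] by simp
  have "(\<integral>\<^sup>+x. epowr (?M x) p \<partial>\<mu>) \<le>
      (\<integral>\<^sup>+x. (\<integral>\<^sup>+t. ?w t * indicator {t. 0 < t \<and> ennreal t < ?M x} t \<partial>lborel) \<partial>\<mu>)"
    by (intro nn_integral_mono epowr_layer_cake p)
  also have "\<dots> = (\<integral>\<^sup>+x. (\<integral>\<^sup>+t. ?w t * indicator {(x, t). 0 < t \<and> ennreal t < ?M x} (x, t) \<partial>lborel) \<partial>\<mu>)"
    by (intro nn_integral_cong) (auto simp: indicator_def)
  also have "\<dots> = (\<integral>\<^sup>+t. (\<integral>\<^sup>+x. ?w t * indicator {(x, t). 0 < t \<and> ennreal t < ?M x} (x, t) \<partial>\<mu>) \<partial>lborel)"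
    by (intro Fubini'[symmetric]) (simp add: case_prod_unfold)
  also have "\<dots> \<le> (\<integral>\<^sup>+t. (\<integral>\<^sup>+x. ennreal ?D * (?w t * h x t) \<partial>\<mu>) \<partial>lborel)"
  proof (rule nn_integral_mono)
    fix t :: real
    show "(\<integral>\<^sup>+x. ?w t * indicator {(x, t). 0 < t \<and> ennreal t < ?M x} (x, t) \<partial>\<mu>) \<le>
        (\<integral>\<^sup>+x. ennreal ?D * (?w t * h x t) \<partial>\<mu>)"
    proof (cases "0 < t")
      case False
      then show ?thesis by (simp add: indicator_def)
    next
      case t: True
      have "(\<integral>\<^sup>+x. ?w t * indicator {(x, t). 0 < t \<and> ennreal t < ?M x} (x, t) \<partial>\<mu>) =
          (\<integral>\<^sup>+x. ?w t * indicator {x. ennreal t < ?M x} x \<partial>\<mu>)"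
        using t by (intro nn_integral_cong) (auto simp: indicator_def)
      also have "\<dots> = ?w t * emeasure \<mu> {x. ennreal t < ?M x}"
        using open_maximal_op_superlevel[OF B, of "ennreal t" n \<mu> f]
        by (intro nn_integral_cmult_indicator) (simp add: sets)
      also have "\<dots> \<le> ?w t * (ennreal ?D *
          (\<integral>\<^sup>+x. ennreal (B (\<bar>f x\<bar> / t)) * indicator {x. s * t < \<bar>f x\<bar>} x \<partial>\<mu>))"
        by (intro mult_left_mono maximal_op_weak_type[OF n ahl B s t f]) simp
      also have "(\<integral>\<^sup>+x. ennreal (B (\<bar>f x\<bar> / t)) * indicator {x. s * t < \<bar>f x\<bar>} x \<partial>\<mu>) =
          (\<integral>\<^sup>+x. h x t \<partial>\<mu>)"
        using t by (intro nn_integral_cong) (auto simp: indicator_def h_def max_def)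
      also have "?w t * (ennreal ?D * (\<integral>\<^sup>+x. h x t \<partial>\<mu>)) = ennreal ?D * (?w t * (\<integral>\<^sup>+x. h x t \<partial>\<mu>))"
        by (rule mult.left_commute)
      also have "\<dots> = (\<integral>\<^sup>+x. ennreal ?D * (?w t * h x t) \<partial>\<mu>)"
        using h'[of t] by (simp add: nn_integral_cmult)
      finally show ?thesis .
    qed
  qed
  also have "\<dots> = (\<integral>\<^sup>+x. (\<integral>\<^sup>+t. ennreal ?D * (?w t * h x t) \<partial>lborel) \<partial>\<mu>)"
    using h by (intro Fubini') (simp add: case_prod_unfold)
  also have "\<dots> \<le> (\<integral>\<^sup>+x. ennreal (?D * p) * ?J * epowr (ennreal \<bar>f x\<bar>) p \<partial>\<mu>)"
  proof (rule nn_integral_mono)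
    fix x assume x: "x \<in> space \<mu>"
    have m: "(\<lambda>t. h x t) \<in> borel_measurable lborel"
      using measurable_compose[OF measurable_Pair1'[OF x] h] by simp
    let ?q = "\<lambda>t. ennreal (t powr (p - 1) * B (\<bar>f x\<bar> / t)) * indicator {t. 0 < t \<and> s * t < \<bar>f x\<bar>} t"
    have eq: "?w t * h x t = ennreal p * (ennreal (t powr (p - 1)) * h x t)"
      and eq': "ennreal (t powr (p - 1)) * h x t = ?q t" for t
      using p young_nonneg[OF B] by (auto simp: h_def indicator_def ennreal_mult mult_ac max_def)
    have "(\<integral>\<^sup>+t. ennreal ?D * (?w t * h x t) \<partial>lborel) =
        (\<integral>\<^sup>+t. ennreal (?D * p) * (ennreal (t powr (p - 1)) * h x t) \<partial>lborel)"
      using p by (simp add: eq ennreal_mult mult.assoc)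
    also have "\<dots> = ennreal (?D * p) * (\<integral>\<^sup>+t. ennreal (t powr (p - 1)) * h x t \<partial>lborel)"
      using m by (intro nn_integral_cmult) auto
    also have "\<dots> = ennreal (?D * p) * (\<integral>\<^sup>+t. ?q t \<partial>lborel)"
      by (simp only: eq')
    also have "\<dots> \<le> ennreal (?D * p) * (ennreal (\<bar>f x\<bar> powr p) * ?J)"
      by (intro mult_left_mono nn_integral_scaled_young_le[OF B s(1)]) auto
    finally show "(\<integral>\<^sup>+t. ennreal ?D * (?w t * h x t) \<partial>lborel) \<le>
        ennreal (?D * p) * ?J * epowr (ennreal \<bar>f x\<bar>) p"
      by (simp add: epowr_def mult_ac)
  qed
  also have "\<dots> = ennreal (?D * p) * ?J * (\<integral>\<^sup>+x. epowr (ennreal \<bar>f x\<bar>) p \<partial>\<mu>)"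
    by (intro nn_integral_cmult) (simp add: epowr_def)
  finally show ?thesis .
qed

lemma epowr_mono:
  assumes "0 \<le> q" "x \<le> y"
  shows "epowr x q \<le> epowr y q"
  using assms by (cases x; cases y) (auto simp: epowr_def top_unique intro!: ennreal_leI powr_mono2)

lemma epowr_cmult:
  assumes "0 \<le> c"
  shows "epowr (ennreal c * x) q = ennreal (c powr q) * epowr x q"
  using assms by (cases "c = 0"; cases x) (auto simp: epowr_def ennreal_mult_top powr_mult simp flip: ennreal_mult)

theorem theorem1p8:
  fixes \<mu> :: "(real ^ 'd) measure" and n p :: real and B :: "real \<Rightarrow> real"
  assumes "0 < n" and "n \<le> real CARD('d)"
    and "upper_Ahlfors n \<mu>"
    and "1 < p"
    and "young_function B" and "B \<in> B_class p"
  shows "\<exists>C::real. 0 \<le> C \<and>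
    (\<forall>f \<in> Lp \<mu> p.
       maximal_op n \<mu> B f \<in> borel_measurable \<mu> \<and>
       Lp_norm \<mu> p (maximal_op n \<mu> B f) \<le> ennreal C * Lp_norm \<mu> p (\<lambda>x. ennreal \<bar>f x\<bar>))"
proof -
  obtain s where s: "0 < s" "B s \<le> 1 / 2" using young_small_value[OF assms(5)] .
  define A where "A = ennreal (2 * (10 * norm (One :: real ^ 'd)) powr n * p) *
    (\<integral>\<^sup>+t. ennreal (t powr (p - 1) * B (1 / t)) * indicator {0<..1/s} t \<partial>lborel)"
  have "A < \<infinity>"
    unfolding A_def using B_class_inverted_integral_finite[OF assms(5,6) s(1)]
    by (auto simp: ennreal_mult_less_top)
  then obtain r where r: "0 \<le> r" "A = ennreal r" by (cases A) auto
  have "Lp_norm \<mu> p (maximal_op n \<mu> B f) \<le>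
      ennreal (r powr (1 / p)) * Lp_norm \<mu> p (\<lambda>x. ennreal \<bar>f x\<bar>)"
    if "f \<in> borel_measurable \<mu>" for f
  proof -
    have "(\<integral>\<^sup>+x. epowr (maximal_op n \<mu> B f x) p \<partial>\<mu>) \<le>
        A * (\<integral>\<^sup>+x. epowr (ennreal \<bar>f x\<bar>) p \<partial>\<mu>)"
      unfolding A_def using assms(4) that
      by (intro nn_integral_epowr_maximal_op_le assms s) auto
    then have "Lp_norm \<mu> p (maximal_op n \<mu> B f) \<le>
        epowr (A * (\<integral>\<^sup>+x. epowr (ennreal \<bar>f x\<bar>) p \<partial>\<mu>)) (1 / p)"
      unfolding Lp_norm_def using assms(4) by (intro epowr_mono) auto
    also have "\<dots> = ennreal (r powr (1 / p)) * Lp_norm \<mu> p (\<lambda>x. ennreal \<bar>f x\<bar>)"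
      unfolding Lp_norm_def unfolding r(2) using r(1) by (rule epowr_cmult)
    finally show ?thesis .
  qed
  moreover have "maximal_op n \<mu> B f \<in> borel_measurable \<mu>" for f
    using borel_measurable_maximal_op[OF assms(5) upper_Ahlfors_sets[OF assms(3)]] .
  ultimately show ?thesis
    by (intro exI[of _ "r powr (1 / p)"]) (auto simp: Lp_def)
qed

end
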